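(* Let $f:I\to I$ be measurable, let $\mathbf a=(a_k)_{k\ge0}$ be a strictly increasing sequence of nonnegative integers, and let $\nu$ be a Borel probability measure on $I$. Let $\mathcal D\subset C(I)$ be countable and dense in the uniform norm. Suppose that for every $\phi\in\mathcal D$ the following hold: (V1) $\displaystyle\frac1n\sum_{k=0}^{n-1}\int_I\phi\circ f^{a_k}\,dm\longrightarrow\int_I\phi\,d\nu$ as $n\to\infty$; (V2) there are constants $C_\phi<\infty$ and $\delta_\phi>0$ such that, for all $n\ge1$, $$\int_I\left|\sum_{k=0}^{n-1}\left(\phi\circ f^{a_k}-\int_I\phi\circ f^{a_k}\,dm\right)\right|^2dm\le C_\phi n^{2-\delta_\phi}.$$ Then, for $m$-almost every $x\in I$, $\displaystyle\frac1n\sum_{k=0}^{n-1}\delta_{f^{a_k}x}\to\nu$ weak-star as $n\to\infty$.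
   Context: $I=[-1,1]$, $m$ is normalized Lebesgue measure on $I$ (so $m(I)=1$), and $C(I)$ is the space of real-valued continuous functions on $I$. *)

theory Defs
  imports "HOL-Probability.Probability"
begin

abbreviation Ivl :: "real set" where
  "Ivl \<equiv> {-1..1}"

abbreviation borel_Ivl :: "real measure" where
  "borel_Ivl \<equiv> restrict_space borel Ivl"

definition leb_Ivl :: "real measure" where
  "leb_Ivl = uniform_measure (restrict_space lborel Ivl) Ivl"

(* The points of this metric space are the functions that are continuous on the interval and
   equal to undefined off it (see mem_C_Ivl), so they correspond one to one to the elements of
   C([-1,1]); the distance is the uniform one. *)
definition C_Ivl :: "(real \<Rightarrow> real) metric" where
  "C_Ivl = cfunspace (top_of_set Ivl) euclidean_metric"

(* (1/n) times the sum of the Dirac measures at y 0, ..., y (n - 1); the zero measure if n = 0. *)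
definition empirical_measure :: "(nat \<Rightarrow> real) \<Rightarrow> nat \<Rightarrow> real measure" where
  "empirical_measure y n = measure_of (space borel_Ivl) (sets borel_Ivl)
     (\<lambda>A. ennreal (1 / real n) * (\<Sum>k<n. emeasure (return borel_Ivl (y k)) A))"

definition weak_star_conv :: "(nat \<Rightarrow> real measure) \<Rightarrow> real measure \<Rightarrow> bool" where
  "weak_star_conv \<mu> \<nu> \<longleftrightarrow>
     (\<forall>\<phi>\<in>mspace C_Ivl. (\<lambda>n. \<integral>x. \<phi> x \<partial>\<mu> n) \<longlonglongrightarrow> (\<integral>x. \<phi> x \<partial>\<nu>))"

lemma space_leb_Ivl [simp]: "space leb_Ivl = Ivl"
  by (simp add: leb_Ivl_def space_restrict_space)

lemma sets_leb_Ivl [simp, measurable_cong]: "sets leb_Ivl = sets borel_Ivl"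
  by (simp add: leb_Ivl_def sets_restrict_space)

lemma prob_space_leb_Ivl: "prob_space leb_Ivl"
  unfolding leb_Ivl_def
  by (rule prob_space_uniform_measure) (simp_all add: emeasure_restrict_space)

lemma mem_C_Ivl: "\<phi> \<in> mspace C_Ivl \<longleftrightarrow> \<phi> \<in> extensional Ivl \<and> continuous_on Ivl \<phi>"
proof -
  have "compactin (top_of_set Ivl) (topspace (top_of_set Ivl))"
    by (simp add: compactin_subtopology)
  then show ?thesis
    by (auto simp: C_Ivl_def compactin_mspace_cfunspace simp del: mspace_cfunspace)
qed

lemma sets_empirical_measure [simp, measurable_cong]:
  "sets (empirical_measure y n) = sets borel_Ivl"
  by (simp only: empirical_measure_def sets.sets_measure_of_eq)

lemma space_empirical_measure [simp]: "space (empirical_measure y n) = Ivl"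
  using sets_eq_imp_space_eq[OF sets_empirical_measure] by (simp add: space_restrict_space)

lemma emeasure_empirical_measure:
  assumes "A \<in> sets borel_Ivl"
  shows "emeasure (empirical_measure y n) A
    = ennreal (1 / real n) * (\<Sum>k<n. emeasure (return borel_Ivl (y k)) A)"
proof (rule emeasure_measure_of[OF empirical_measure_def])
  show "sets borel_Ivl \<subseteq> Pow (space borel_Ivl)"
    by (rule sets.space_closed)
  show "A \<in> sets (empirical_measure y n)"
    using assms by simp
  show "positive (sets (empirical_measure y n))
    (\<lambda>A. ennreal (1 / real n) * (\<Sum>k<n. emeasure (return borel_Ivl (y k)) A))"
    by (simp add: positive_def)
  show "countably_additive (sets (empirical_measure y n))
    (\<lambda>A. ennreal (1 / real n) * (\<Sum>k<n. emeasure (return borel_Ivl (y k)) A))"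
  proof (rule countably_additiveI)
    fix B :: "nat \<Rightarrow> real set"
    assume B: "range B \<subseteq> sets (empirical_measure y n)" "disjoint_family B"
    have "(\<Sum>i. ennreal (1 / real n) * (\<Sum>k<n. emeasure (return borel_Ivl (y k)) (B i)))
      = ennreal (1 / real n) * (\<Sum>k<n. (\<Sum>i. emeasure (return borel_Ivl (y k)) (B i)))"
      by (subst ennreal_suminf_cmult, subst suminf_sum) (auto intro: summableI)
    also have "\<dots> = ennreal (1 / real n) * (\<Sum>k<n. emeasure (return borel_Ivl (y k)) (\<Union>i. B i))"
      using B by (intro arg_cong2[where f = "(*)"] refl sum.cong suminf_emeasure)
        (simp_all only: sets_return sets_empirical_measure)
    finally show "(\<Sum>i. ennreal (1 / real n) * (\<Sum>k<n. emeasure (return borel_Ivl (y k)) (B i)))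
      = ennreal (1 / real n) * (\<Sum>k<n. emeasure (return borel_Ivl (y k)) (\<Union>i. B i))" .
  qed
qed

end

theory Submission
  imports Defs
begin

text \<open>
  For fixed \<open>\<phi>\<close> in \<open>D\<close> let \<open>S n\<close> be the sum of the first \<open>n\<close> centred observables. By (V2) the
  integral of \<open>(S n)\<^sup>2 / n ^ 3\<close> is \<open>O(n powr (- 1 - \<delta>))\<close>, so the series of these functions converges
  almost everywhere. No passage to a sparse subsequence is needed: the increments of \<open>S\<close> are bounded,
  so a single large value of \<open>S n / n\<close> persists over a block of indices of length proportional to \<open>n\<close>,
  and each such block contributes a fixed amount to the series. Hence \<open>S n / n\<close> tends to 0, and
  with (V1) the averages of \<open>\<phi>\<close> converge almost everywhere. Countability and uniform density of \<open>D\<close>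
  give one null set that serves all continuous functions.
\<close>

section \<open>Real sequences with bounded increments\<close>

lemma lipschitz_summable_imp_ratio_tendsto_0:
  fixes u :: "nat \<Rightarrow> real"
  assumes lip: "\<And>n. \<bar>u (Suc n) - u n\<bar> \<le> B"
    and sm: "summable (\<lambda>n. (u n)\<^sup>2 / real n ^ 3)"
  shows "(\<lambda>n. u n / real n) \<longlonglongrightarrow> 0"
proof (rule LIMSEQ_I)
  fix r :: real assume "r > 0"
  \<comment> \<open>The maximum with 1 makes division by \<open>K\<close> legitimate even if
    \<open>B = 0\<close>. Capping \<open>e\<close> at \<open>K\<close> will keep the block length
    \<open>L\<close> at most \<open>n\<close>.\<close>
  define K where "K = max B 1"
  define e where "e = min r K"
  have K: "K > 0" "B \<le> K" by (auto simp: K_def)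
  have e: "e > 0" "e \<le> r" "e \<le> K" using \<open>r > 0\<close> K by (auto simp: e_def)
  have step: "\<bar>u (n + i) - u n\<bar> \<le> real i * K" for n i
  proof (induction i)
    case (Suc i)
    then show ?case using lip[of "n + i"] K by (simp add: algebra_simps)
  qed simp
  \<comment> \<open>the block from \<open>n\<close> to \<open>n + L\<close> below, with \<open>L\<close> about \<open>e n / (2 K)\<close>, has terms at least
    \<open>(e n / 2)\<^sup>2 / (2 n) ^ 3\<close>\<close>
  define c where "c = e ^ 3 / (64 * K)"
  have "c > 0" using e K by (simp add: c_def)
  then obtain N where N: "\<And>m n. m \<ge> N \<Longrightarrow> \<bar>\<Sum>k=m..<n. (u k)\<^sup>2 / real k ^ 3\<bar> < c"
    using sm unfolding summable_Cauchy by (metis real_norm_def)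
  have "\<bar>u n\<bar> < e * real n" if n: "n \<ge> max N 1" for n
  proof (rule ccontr)
    assume big: "\<not> \<bar>u n\<bar> < e * real n"
    define L where "L = nat \<lfloor>e * real n / (2 * K)\<rfloor>"
    have npos: "real n > 0" using n by simp
    have "e * real n / (2 * K) \<ge> 0" using e K by simp
    \<comment> \<open>Rounding down serves both sides: the bound on \<open>L\<close> limits the
      drift of \<open>u\<close> over the block, the bound on \<open>Suc L\<close> counts its
      terms.\<close>
    then have L: "real L \<le> e * real n / (2 * K)" "e * real n / (2 * K) \<le> real (Suc L)"
      unfolding L_def by linarith+
    then have LK: "real L * K \<le> e * real n / 2"
      using K by (simp add: field_simps)
    also have "\<dots> \<le> real n * K"
      using mult_right_mono[OF e(3), of "real n"] mult_pos_pos[OF npos K(1)]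
      by (simp add: mult.commute)
    finally have Ln: "L \<le> n" using K by simp
    have term_ge: "e\<^sup>2 / (32 * real n) \<le> (u m)\<^sup>2 / real m ^ 3" if m: "m \<in> {n..<n + Suc L}" for m
    proof -
      obtain i where i: "m = n + i" "i \<le> L" using m
        by (metis add_Suc_right atLeastLessThan_iff le_Suc_ex less_Suc_eq_le nat_add_left_cancel_le)
      have "real i * K \<le> real L * K" using i K by simp
      \<comment> \<open>Drifting at most \<open>K\<close> per step, \<open>u\<close> loses no more
        than half of its initial size \<open>e * real n\<close> on the block.\<close>
      then have "\<bar>u m\<bar> \<ge> e * real n / 2"
        using step[of n i] LK big unfolding i(1) by linarith
      then have "(e * real n / 2)\<^sup>2 \<le> (u m)\<^sup>2"
        using e npos by (intro abs_le_square_iff[THEN iffD1]) auto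
      moreover have "real m ^ 3 \<le> (2 * real n) ^ 3"
        using i Ln by (intro power_mono) auto
      ultimately have "(e * real n / 2)\<^sup>2 / (2 * real n) ^ 3 \<le> (u m)\<^sup>2 / real m ^ 3"
        using npos i by (intro frac_le) auto
      moreover have "(e * real n / 2)\<^sup>2 / (2 * real n) ^ 3 = e\<^sup>2 / (32 * real n)"
        using npos by (simp add: field_simps power2_eq_square power3_eq_cube)
      ultimately show ?thesis by simp
    qed
    \<comment> \<open>Number of terms times size of a term: \<open>n\<close> cancels, so each such
      block contributes at least the fixed amount \<open>c\<close>, against the Cauchy
      criterion.\<close>
    have "c = (e * real n / (2 * K)) * (e\<^sup>2 / (32 * real n))"
      using npos K by (simp add: c_def field_simps power2_eq_square power3_eq_cube)
    also have "\<dots> \<le> real (Suc L) * (e\<^sup>2 / (32 * real n))"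
      by (intro mult_right_mono L) simp
    also have "\<dots> = (\<Sum>m=n..<n + Suc L. e\<^sup>2 / (32 * real n))" by simp
    also have "\<dots> \<le> (\<Sum>m=n..<n + Suc L. (u m)\<^sup>2 / real m ^ 3)"
      by (rule sum_mono[OF term_ge])
    also have "\<dots> < c" using N[of n "n + Suc L"] n by linarith
    finally show False by simp
  qed
  then have "norm (u n / real n - 0) < r" if "n \<ge> max N 1" for n
    using that less_le_trans[OF _ mult_right_mono[OF e(2), of "real n"]]
    by (simp add: pos_divide_less_eq)
  then show "\<exists>no. \<forall>n\<ge>no. norm (u n / real n - 0) < r"
    by blast
qed

text \<open>A strong law of large numbers from a power saving in the second moments. The bound
  \<open>B\<close> is used twice: it makes the squares integrable, and it bounds the increments of
  the partial sums at every point, as the preceding lemma demands.\<close>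

lemma (in finite_measure) AE_mean_tendsto_0:
  fixes X :: "nat \<Rightarrow> 'a \<Rightarrow> real"
  assumes X [measurable]: "\<And>k. X k \<in> borel_measurable M"
    and bdd: "\<And>k x. x \<in> space M \<Longrightarrow> \<bar>X k x\<bar> \<le> B"
    and "\<delta> > 0"
    and var: "\<And>n. n \<ge> 1 \<Longrightarrow>
      (\<integral>x. \<bar>\<Sum>k<n. X k x\<bar>\<^sup>2 \<partial>M) \<le> C * real n powr (2 - \<delta>)"
  shows "AE x in M. (\<lambda>n. (\<Sum>k<n. X k x) / real n) \<longlonglongrightarrow> 0"
proof -
  define S where "S n x = (\<Sum>k<n. X k x)" for n x
  have [measurable]: "S n \<in> borel_measurable M" for n
    unfolding S_def by simp
  have int: "integrable M (\<lambda>x. (S n x)\<^sup>2 / real n ^ 3)" for n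
  proof (rule integrable_const_bound[where B = "(real n * B)\<^sup>2 / real n ^ 3"])
    have "\<bar>S n x\<bar> \<le> real n * B" if "x \<in> space M" for x
      unfolding S_def using sum_bounded_above[of "{..<n}" "\<lambda>k. \<bar>X k x\<bar>" B] bdd[OF that]
      by (intro order_trans[OF sum_abs]) simp
    then have "(S n x)\<^sup>2 \<le> (real n * B)\<^sup>2" if "x \<in> space M" for x
      using that by (simp add: abs_le_square_iff[symmetric] abs_le_iff)
        (meson abs_ge_self abs_le_iff order_trans)
    then show "AE x in M. norm ((S n x)\<^sup>2 / real n ^ 3) \<le> (real n * B)\<^sup>2 / real n ^ 3"
      by (auto intro!: divide_right_mono)
  qed simp
  \<comment> \<open>At \<open>n = 0\<close> both sides are 0, since \<open>S 0\<close> is the empty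
    sum and \<open>0 powr _ = 0\<close>.\<close>
  have le: "(\<integral>x. (S n x)\<^sup>2 / real n ^ 3 \<partial>M) \<le> \<bar>C\<bar> * real n powr (- 1 - \<delta>)" for n
  proof (cases "n = 0")
    case False
    have "(\<integral>x. (S n x)\<^sup>2 / real n ^ 3 \<partial>M) = (\<integral>x. \<bar>\<Sum>k<n. X k x\<bar>\<^sup>2 \<partial>M) / real n ^ 3"
      by (simp add: S_def)
    also have "\<dots> \<le> (C * real n powr (2 - \<delta>)) / real n ^ 3"
      using False by (intro divide_right_mono var) auto
    also have "\<dots> = C * real n powr (- 1 - \<delta>)"
    proof -
      have "real n powr (- 1 - \<delta>) = real n powr ((2 - \<delta>) - 3)" by simp
      also have "\<dots> = real n powr (2 - \<delta>) / real n ^ 3"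
        using False by (simp only: powr_diff) (simp add: powr_numeral)
      finally show ?thesis by simp
    qed
    also have "\<dots> \<le> \<bar>C\<bar> * real n powr (- 1 - \<delta>)"
      by (intro mult_right_mono) auto
    finally show ?thesis .
  qed simp
  have "summable (\<lambda>n. \<bar>C\<bar> * real n powr (- 1 - \<delta>))"
    using \<open>\<delta> > 0\<close> by (intro summable_mult) (simp add: summable_real_powr_iff)
  then have sum_int: "summable (\<lambda>n. \<integral>x. (S n x)\<^sup>2 / real n ^ 3 \<partial>M)"
    by (rule summable_comparison_test') (use le in auto)
  \<comment> \<open>Monotone convergence in the extended nonnegative reals: the integral of the
    series is the sum of the integrals, hence finite, so the series is finite almost
    everywhere.\<close>
  have "(\<integral>\<^sup>+x. (\<Sum>n. ennreal ((S n x)\<^sup>2 / real n ^ 3)) \<partial>M)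
      = (\<Sum>n. \<integral>\<^sup>+x. ennreal ((S n x)\<^sup>2 / real n ^ 3) \<partial>M)"
    by (rule nn_integral_suminf) simp
  also have "\<dots> = (\<Sum>n. ennreal (\<integral>x. (S n x)\<^sup>2 / real n ^ 3 \<partial>M))"
    by (intro suminf_cong nn_integral_eq_integral int) simp
  also have "\<dots> \<noteq> \<infinity>"
    using sum_int by (simp add: suminf_ennreal2 integral_nonneg_AE)
  finally have "AE x in M. (\<Sum>n. ennreal ((S n x)\<^sup>2 / real n ^ 3)) \<noteq> \<infinity>"
    by (intro nn_integral_PInf_AE) simp_all
  then have "AE x in M. (\<lambda>n. S n x / real n) \<longlonglongrightarrow> 0"
    using AE_space
  proof eventually_elim
    case x: (elim x)
    show "(\<lambda>n. S n x / real n) \<longlonglongrightarrow> 0"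
    proof (rule lipschitz_summable_imp_ratio_tendsto_0)
      show "\<bar>S (Suc n) x - S n x\<bar> \<le> B" for n
        using bdd[OF x(2)] by (simp add: S_def)
      show "summable (\<lambda>n. (S n x)\<^sup>2 / real n ^ 3)"
        using x(1) by (intro summable_suminf_not_top) auto
    qed
  qed
  then show ?thesis by (simp add: S_def)
qed

section \<open>Empirical measures and the space of continuous functions\<close>

text \<open>For \<open>n > 0\<close> the empirical measure is the image under \<open>y\<close> of
  the uniform distribution on \<open>{..<n}\<close>, and a change of variables gives a finite
  average. For \<open>n = 0\<close> it is the zero measure, and the right side is 0 as well.\<close>

lemma integral_empirical_measure:
  assumes y: "\<And>k. y k \<in> Ivl" and \<phi>: "\<phi> \<in> borel_measurable borel_Ivl"
  shows "(\<integral>x. \<phi> x \<partial>empirical_measure y n) = (1 / real n) * (\<Sum>k<n. \<phi> (y k))"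
proof (cases "n = 0")
  case True
  then have "emeasure (empirical_measure y n) A = 0" for A
    using emeasure_empirical_measure[of A y n] emeasure_notin_sets[of A "empirical_measure y n"]
    by (cases "A \<in> sets borel_Ivl") auto
  \<comment> \<open>The whole space is a null set here, so every function vanishes almost
    everywhere.\<close>
  then have "AE x in empirical_measure y n. \<phi> x = 0"
    by (intro AE_I[where N = "space (empirical_measure y n)"]) (simp_all only: sets.top, auto)
  then have "(\<integral>x. \<phi> x \<partial>empirical_measure y n) = 0"
    by (rule integral_eq_zero_AE)
  then show ?thesis using True by simp
next
  case False
  let ?U = "pmf_of_set {..<n}"
  have ne: "{..<n} \<noteq> {}" "finite {..<n}" using False by auto
  have m: "y \<in> measurable (measure_pmf ?U) borel_Ivl"
    using y by (auto simp: space_restrict_space)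
  have "empirical_measure y n = distr (measure_pmf ?U) borel_Ivl y"
  proof (rule measure_eqI)
    fix A assume "A \<in> sets (empirical_measure y n)"
    then have A: "A \<in> sets borel_Ivl" by simp
    have "emeasure (distr (measure_pmf ?U) borel_Ivl y) A = emeasure (measure_pmf ?U) (y -` A)"
      using emeasure_distr[OF m A] by simp
    also have "\<dots> = ennreal (1 / real n) * of_nat (card ({..<n} \<inter> y -` A))"
      using ne False by (simp add: emeasure_pmf_of_set ennreal_of_nat_eq_real_of_nat ennreal_mult[symmetric])
    also have "of_nat (card ({..<n} \<inter> y -` A)) = (\<Sum>k<n. emeasure (return borel_Ivl (y k)) A)"
      using A by (simp add: indicator_def sum.If_cases vimage_def Collect_conj_eq)
    finally show "emeasure (empirical_measure y n) A = emeasure (distr (measure_pmf ?U) borel_Ivl y) A"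
      using A by (simp add: emeasure_empirical_measure)
  qed simp
  then have "(\<integral>x. \<phi> x \<partial>empirical_measure y n) = (\<integral>k. \<phi> (y k) \<partial>measure_pmf ?U)"
    using integral_distr[OF m \<phi>] by simp
  also have "\<dots> = (\<Sum>k<n. \<phi> (y k)) / real n"
    using ne by (subst integral_pmf_of_set) auto
  finally show ?thesis by simp
qed

text \<open>Translates topological density into pointwise estimates: a metric ball around \<psi>
  meets \<open>D\<close>, and the uniform distance dominates the distance of the values at each
  point.\<close>

lemma C_Ivl_closure_of_approx:
  assumes "\<psi> \<in> mtopology_of C_Ivl closure_of D" "\<epsilon> > 0"
  obtains \<phi> where "\<phi> \<in> D" "\<And>x. x \<in> Ivl \<Longrightarrow> \<bar>\<psi> x - \<phi> x\<bar> \<le> \<epsilon>"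
proof -
  interpret Metric_space "mspace C_Ivl" "mdist C_Ivl"
    by (rule Metric_space_mspace_mdist)
  obtain \<phi> where \<phi>: "\<phi> \<in> D" "\<phi> \<in> mball \<psi> \<epsilon>"
    using assms by (auto simp: mtopology_of_def metric_closure_of)
  then have "\<psi> \<in> mspace C_Ivl" "\<phi> \<in> mspace C_Ivl" "mdist C_Ivl \<psi> \<phi> \<le> \<epsilon>"
    by auto
  then have "\<bar>\<psi> x - \<phi> x\<bar> \<le> \<epsilon>" if "x \<in> Ivl" for x
    using mdist_cfunspace_imp_mdist_le[of \<psi> "top_of_set Ivl" euclidean_metric \<phi> \<epsilon> x] that
    by (simp add: C_Ivl_def dist_real_def del: mspace_cfunspace)
  with \<phi>(1) show ?thesis by (rule that)
qed

lemma C_Ivl_bounded: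
  assumes "\<phi> \<in> mspace C_Ivl"
  obtains B where "\<And>x. x \<in> Ivl \<Longrightarrow> \<bar>\<phi> x\<bar> \<le> B"
proof -
  have "bounded (\<phi> ` Ivl)"
    using assms by (intro compact_imp_bounded compact_continuous_image) (auto simp: mem_C_Ivl)
  then obtain B where "\<forall>x\<in>Ivl. \<bar>\<phi> x\<bar> \<le> B"
    by (auto simp: bounded_iff)
  then show ?thesis using that by blast
qed

lemma C_Ivl_measurable: "\<phi> \<in> mspace C_Ivl \<Longrightarrow> \<phi> \<in> borel_measurable borel_Ivl"
  by (simp add: mem_C_Ivl borel_measurable_continuous_on_restrict)

section \<open>Almost sure weak-star convergence\<close>

theorem theorem5p1:
  fixes f :: "real \<Rightarrow> real" and a :: "nat \<Rightarrow> nat" and \<nu> :: "real measure"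
    and D :: "(real \<Rightarrow> real) set"
  assumes "f \<in> borel_Ivl \<rightarrow>\<^sub>M borel_Ivl"
    and "strict_mono a"
    and "prob_space \<nu>" and "sets \<nu> = sets borel_Ivl"
    and "D \<subseteq> mspace C_Ivl" and "countable D"
    and "mtopology_of C_Ivl closure_of D = mspace C_Ivl"
    and V1: "\<And>\<phi>. \<phi> \<in> D \<Longrightarrow>
      (\<lambda>n. (1 / real n) * (\<Sum>k<n. \<integral>x. \<phi> ((f ^^ a k) x) \<partial>leb_Ivl)) \<longlonglongrightarrow> (\<integral>x. \<phi> x \<partial>\<nu>)"
    and V2: "\<And>\<phi>. \<phi> \<in> D \<Longrightarrow> \<exists>C \<delta> :: real. \<delta> > 0 \<and> (\<forall>n\<ge>1.
      (\<integral>x. \<bar>\<Sum>k<n. (\<phi> ((f ^^ a k) x) - (\<integral>y. \<phi> ((f ^^ a k) y) \<partial>leb_Ivl))\<bar>\<^sup>2 \<partial>leb_Ivl)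
        \<le> C * real n powr (2 - \<delta>))"
  shows "AE x in leb_Ivl. weak_star_conv (empirical_measure (\<lambda>k. (f ^^ a k) x)) \<nu>"
proof -
  interpret leb: prob_space leb_Ivl by (rule prob_space_leb_Ivl)
  interpret \<nu>: prob_space \<nu> by fact
  have space_\<nu>: "space \<nu> = Ivl"
    using sets_eq_imp_space_eq[OF \<open>sets \<nu> = sets borel_Ivl\<close>] by (simp add: space_restrict_space)
  have iter [measurable]: "f ^^ i \<in> borel_Ivl \<rightarrow>\<^sub>M borel_Ivl" for i
    using assms(1) by (rule measurable_compose_n)
  have iter_Ivl: "(f ^^ i) x \<in> Ivl" if "x \<in> Ivl" for i x
    using measurable_space[OF iter, of x i] that by (simp add: space_restrict_space)
  \<comment> \<open>For a continuous \<phi> and a point \<open>x\<close> of the interval these are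
    the integrals of \<phi> against the empirical measures of the orbit along
    \<open>a\<close>.\<close>
  define A where "A \<phi> n x = (1 / real n) * (\<Sum>k<n. \<phi> ((f ^^ a k) x))" for \<phi> :: "real \<Rightarrow> real" and n x
  have "AE x in leb_Ivl. (\<lambda>n. A \<phi> n x) \<longlonglongrightarrow> (\<integral>x. \<phi> x \<partial>\<nu>)" if "\<phi> \<in> D" for \<phi>
  proof -
    note \<phi>_D = that
    have \<phi>: "\<phi> \<in> mspace C_Ivl" using that assms(5) by blast
    obtain B where B: "\<And>x. x \<in> Ivl \<Longrightarrow> \<bar>\<phi> x\<bar> \<le> B" using C_Ivl_bounded[OF \<phi>] by blast
    obtain C \<delta> where "\<delta> > 0" and C: "\<And>n. n \<ge> 1 \<Longrightarrow>
      (\<integral>x. \<bar>\<Sum>k<n. (\<phi> ((f ^^ a k) x) - (\<integral>y. \<phi> ((f ^^ a k) y) \<partial>leb_Ivl))\<bar>\<^sup>2 \<partial>leb_Ivl)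
        \<le> C * real n powr (2 - \<delta>)"
      using V2[OF \<phi>_D] by blast
    note C_Ivl_measurable[OF \<phi>, measurable]
    let ?I = "\<lambda>k. \<integral>y. \<phi> ((f ^^ a k) y) \<partial>leb_Ivl"
    have "\<bar>?I k\<bar> \<le> B" for k
    proof -
      have "\<bar>?I k\<bar> \<le> (\<integral>y. \<bar>\<phi> ((f ^^ a k) y)\<bar> \<partial>leb_Ivl)" by (rule integral_abs_bound)
      also have "\<dots> \<le> B"
        using B iter_Ivl
        by (intro leb.integral_le_const leb.integrable_const_bound[where B = B] AE_I2) auto
      finally show ?thesis .
    qed
    \<comment> \<open>One \<open>B\<close> for the value and one for its mean.\<close>
    then have "\<bar>\<phi> ((f ^^ a k) x) - ?I k\<bar> \<le> B + B" if "x \<in> Ivl" for k x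
      by (intro order_trans[OF abs_triangle_ineq4] add_mono B iter_Ivl that)
    then have "AE x in leb_Ivl. (\<lambda>n. (\<Sum>k<n. \<phi> ((f ^^ a k) x) - ?I k) / real n) \<longlonglongrightarrow> 0"
      using \<open>\<delta> > 0\<close> C by (intro leb.AE_mean_tendsto_0[where B = "B + B"]) auto
    then show ?thesis
    proof eventually_elim
      case (elim x)
      \<comment> \<open>The averages of the means from (V1) restore what the centring
        removed.\<close>
      from tendsto_add[OF this V1[OF \<phi>_D]] show "(\<lambda>n. A \<phi> n x) \<longlonglongrightarrow> (\<integral>x. \<phi> x \<partial>\<nu>)"
        by (simp add: A_def sum_subtractf diff_divide_distrib)
    qed
  qed
  then have "AE x in leb_Ivl. \<forall>\<phi>\<in>D. (\<lambda>n. A \<phi> n x) \<longlonglongrightarrow> (\<integral>x. \<phi> x \<partial>\<nu>)"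
    using \<open>countable D\<close> by (simp add: AE_ball_countable)
  then show ?thesis
    using AE_space
  proof eventually_elim
    case (elim x)
    then have conv: "\<forall>\<phi>\<in>D. (\<lambda>n. A \<phi> n x) \<longlonglongrightarrow> (\<integral>x. \<phi> x \<partial>\<nu>)" and x: "x \<in> Ivl"
      by simp_all
    have int: "integrable \<nu> \<phi>" if \<phi>: "\<phi> \<in> mspace C_Ivl" for \<phi>
    proof -
      obtain B where "\<And>x. x \<in> Ivl \<Longrightarrow> \<bar>\<phi> x\<bar> \<le> B" using C_Ivl_bounded[OF \<phi>] by blast
      then show ?thesis
        using C_Ivl_measurable[OF \<phi>] \<open>sets \<nu> = sets borel_Ivl\<close>
        by (intro \<nu>.integrable_const_bound[where B = B] AE_I2)
          (simp_all add: space_\<nu> cong: measurable_cong_sets)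
    qed
    show "weak_star_conv (empirical_measure (\<lambda>k. (f ^^ a k) x)) \<nu>"
      unfolding weak_star_conv_def
    proof (intro ballI LIMSEQ_I)
      fix \<psi> and r :: real assume \<psi>: "\<psi> \<in> mspace C_Ivl" and "r > 0"
      \<comment> \<open>With \<open>x\<close> fixed outside the null set, what remains is a
        deterministic three-term estimate: replace \<psi> by \<phi> in the average, pass to the
        limit for \<phi>, replace \<phi> by \<psi> in the limit. Each costs \<open>r / 3\<close>,
        and the middle one is strict.\<close>
      obtain \<phi> where "\<phi> \<in> D" and close: "\<And>x. x \<in> Ivl \<Longrightarrow> \<bar>\<psi> x - \<phi> x\<bar> \<le> r / 3"
        using C_Ivl_closure_of_approx[of \<psi> D "r / 3"] \<psi> \<open>r > 0\<close> assms(7) by auto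
      then have \<phi>: "\<phi> \<in> mspace C_Ivl" using assms(5) by blast
      have "\<bar>(\<integral>x. \<psi> x \<partial>\<nu>) - (\<integral>x. \<phi> x \<partial>\<nu>)\<bar> = \<bar>\<integral>x. \<psi> x - \<phi> x \<partial>\<nu>\<bar>"
        using int[OF \<psi>] int[OF \<phi>] by simp
      also have "\<dots> \<le> (\<integral>x. \<bar>\<psi> x - \<phi> x\<bar> \<partial>\<nu>)" by (rule integral_abs_bound)
      also have "\<dots> \<le> r / 3"
        using int[OF \<psi>] int[OF \<phi>] close by (intro \<nu>.integral_le_const AE_I2) (auto simp: space_\<nu>)
      finally have lim: "\<bar>(\<integral>x. \<psi> x \<partial>\<nu>) - (\<integral>x. \<phi> x \<partial>\<nu>)\<bar> \<le> r / 3" .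
      \<comment> \<open>The estimate is uniform in \<open>n\<close> because the orbit stays in the
        interval; at \<open>n = 0\<close> both averages are 0.\<close>
      have avg: "\<bar>A \<psi> n x - A \<phi> n x\<bar> \<le> r / 3" for n
      proof -
        have "\<bar>\<Sum>k<n. \<psi> ((f ^^ a k) x) - \<phi> ((f ^^ a k) x)\<bar> \<le> real n * (r / 3)"
          using sum_bounded_above[of "{..<n}" "\<lambda>k. \<bar>\<psi> ((f ^^ a k) x) - \<phi> ((f ^^ a k) x)\<bar>" "r / 3"]
            close iter_Ivl[OF x]
          by (intro order_trans[OF sum_abs]) simp
        moreover have "A \<psi> n x - A \<phi> n x = (\<Sum>k<n. \<psi> ((f ^^ a k) x) - \<phi> ((f ^^ a k) x)) / real n"
          by (simp add: A_def sum_subtractf diff_divide_distrib)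
        ultimately show ?thesis
          using \<open>r > 0\<close> by (cases "n = 0") (simp_all add: pos_divide_le_eq mult.commute)
      qed
      obtain N where N: "\<And>n. n \<ge> N \<Longrightarrow> \<bar>A \<phi> n x - (\<integral>x. \<phi> x \<partial>\<nu>)\<bar> < r / 3"
        using LIMSEQ_D[OF bspec[OF conv \<open>\<phi> \<in> D\<close>], of "r / 3"] \<open>r > 0\<close> by auto
      have "(\<integral>y. \<psi> y \<partial>empirical_measure (\<lambda>k. (f ^^ a k) x) n) = A \<psi> n x" for n
        unfolding A_def by (intro integral_empirical_measure iter_Ivl x C_Ivl_measurable \<psi>)
      moreover have "\<bar>A \<psi> n x - (\<integral>x. \<psi> x \<partial>\<nu>)\<bar> < r" if "n \<ge> N" for n
        using avg[of n] lim N[OF that] by linarith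
      ultimately show "\<exists>N. \<forall>n\<ge>N.
          norm ((\<integral>y. \<psi> y \<partial>empirical_measure (\<lambda>k. (f ^^ a k) x) n) - (\<integral>x. \<psi> x \<partial>\<nu>)) < r"
        by auto
    qed
  qed
qed

end
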